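(* Let $H$ be a Hilbert space and consider the problem $$\dot u=A(t)u+F(t,u),\quad t\ge 0,\qquad u(0)=u_0,$$ where, for $t\ge 0$, $A(t)$ is a linear closed densely defined operator in $H$ with domain $D(A)$ independent of $t$, $u_0\in D(A)$, and $F(t,u)$ is a nonlinear mapping, locally Lipschitz with respect to $u$, satisfying $$\|F(t,u)\|\le c_0\|u\|^{1+p},$$ with constants $p>0$, $c_0>0$. Assume also that $$\operatorname{Re}(A(t)u,u)\le -\gamma(t)\|u\|^2\qquad \forall u\in D(A),\ t\ge 0,$$ where $$\gamma(t)=\frac{b_1}{(b_0+t)^d},\qquad d=\mathrm{const}\in(0,1],$$ and $b_0,b_1$ are positive constants (so that $\gamma(t)>0$ and $\lim_{t\to\infty}\gamma(t)=0$). Assume that $b_1>0$ is sufficiently large (depending on $d,b_0,c_0,p$ and the fixed initial data). Then the zero solution to $\dot u=A(t)u+F(t,u)$ is asymptotically stable for any fixed initial data $u(0)$.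
   Context: $(\cdot,\cdot)$ and $\|\cdot\|$ are the inner product and norm of $H$, and $\dot u=\frac{du}{dt}$ is the strong derivative. The zero solution is called Lyapunov stable if for any sufficiently small $\epsilon>0$ there exists $\delta=\delta(\epsilon)>0$ such that, if $\|u_0\|<\delta$, then the solution to the problem with $u(0)=u_0$ exists on $[0,\infty)$ and $\|u(t)\|\le\epsilon$. If, in addition, $\lim_{t\to\infty}\|u(t)\|=0$, the zero solution is called asymptotically stable. "For any fixed initial data $u(0)$" means that $u(0)=u_0$ is fixed and is not required to be small: the solution with this initial value exists on $[0,\infty)$ and $\lim_{t\to\infty}\|u(t)\|=0$.
   Formalization: Local existence is added as an assumption: from every time s≥0 and every v in D(A) a strong solution exists locally, for a time uniform over bounded s and bounded ‖v‖; without it the claim fails, e.g. A=d/dx−c on H^1_0(0,∞), F=0. *)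

theory Defs
  imports "HOL-Analysis.Analysis"
begin

text \<open>Complex Hilbert spaces: Banach spaces whose real scalar multiplication extends to the
  complex numbers and whose norm comes from a complex inner product, linear in its first
  argument. Topology and vector derivatives are those of the underlying real Banach space.\<close>

class complex_hilbert = banach +
  fixes scaleC :: "complex \<Rightarrow> 'a \<Rightarrow> 'a"
    and cinner :: "'a \<Rightarrow> 'a \<Rightarrow> complex"
  assumes scaleC_add_right: "scaleC a (x + y) = scaleC a x + scaleC a y"
    and scaleC_add_left: "scaleC (a + b) x = scaleC a x + scaleC b x"
    and scaleC_scaleC: "scaleC a (scaleC b x) = scaleC (a * b) x"
    and scaleC_of_real: "scaleC (complex_of_real r) x = r *\<^sub>R x"
    and cinner_commute: "cinner x y = cnj (cinner y x)"
    and cinner_add_left: "cinner (x + y) z = cinner x z + cinner y z"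
    and cinner_scaleC_left: "cinner (scaleC a x) y = a * cinner x y"
    and cinner_self: "cinner x x = complex_of_real ((norm x)\<^sup>2)"

instantiation complex :: complex_hilbert
begin

definition scaleC_complex :: "complex \<Rightarrow> complex \<Rightarrow> complex"
  where "scaleC_complex a x = a * x"

definition cinner_complex :: "complex \<Rightarrow> complex \<Rightarrow> complex"
  where "cinner_complex x y = x * cnj y"

instance
  by standard
    (simp_all add: scaleC_complex_def cinner_complex_def algebra_simps scaleR_conv_of_real
      complex_mult_cnj cmod_power2 flip: power2_eq_square)

end

text \<open>An operator with domain \<open>D\<close> is given by a total function of which only the values on
  \<open>D\<close> matter.\<close>

definition linear_operator_on :: "'h::complex_hilbert set \<Rightarrow> ('h \<Rightarrow> 'h) \<Rightarrow> bool" where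
  "linear_operator_on D A \<longleftrightarrow>
     0 \<in> D \<and>
     (\<forall>x\<in>D. \<forall>y\<in>D. x + y \<in> D \<and> A (x + y) = A x + A y) \<and>
     (\<forall>a. \<forall>x\<in>D. scaleC a x \<in> D \<and> A (scaleC a x) = scaleC a (A x))"

definition closed_densely_defined_operator :: "'h::complex_hilbert set \<Rightarrow> ('h \<Rightarrow> 'h) \<Rightarrow> bool" where
  "closed_densely_defined_operator D A \<longleftrightarrow>
     linear_operator_on D A \<and> closed ((\<lambda>x. (x, A x)) ` D) \<and> closure D = UNIV"

text \<open>Strong solutions of \<open>u' = A(t) u + F(t, u)\<close> on a time interval \<open>I\<close>; the derivative is
  one-sided at the endpoints belonging to \<open>I\<close>.\<close>

definition strong_solution_on ::
  "'h::complex_hilbert set \<Rightarrow> (real \<Rightarrow> 'h \<Rightarrow> 'h) \<Rightarrow> (real \<Rightarrow> 'h \<Rightarrow> 'h) \<Rightarrow> real set \<Rightarrow> (real \<Rightarrow> 'h) \<Rightarrow> bool"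
  where
  "strong_solution_on D A F I u \<longleftrightarrow>
     (\<forall>t\<in>I. u t \<in> D \<and> (u has_vector_derivative (A t (u t) + F t (u t))) (at t within I))"

definition global_solution ::
  "'h::complex_hilbert set \<Rightarrow> (real \<Rightarrow> 'h \<Rightarrow> 'h) \<Rightarrow> (real \<Rightarrow> 'h \<Rightarrow> 'h) \<Rightarrow> 'h \<Rightarrow> (real \<Rightarrow> 'h) \<Rightarrow> bool"
  where
  "global_solution D A F v u \<longleftrightarrow> u 0 = v \<and> strong_solution_on D A F {0..} u"

text \<open>Local solvability: the initial value problem can be solved locally from every starting
  time, and the length of the existence interval depends only on bounds for the starting time
  and for the norm of the initial value. This is the usual local existence theory for a locally
  Lipschitz nonlinearity; it does not follow from closedness, density of the domain and the
  dissipativity estimate alone (take the generator restricted to a smaller domain, or a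
  right-hand side which jumps in time).\<close>

definition locally_solvable ::
  "'h::complex_hilbert set \<Rightarrow> (real \<Rightarrow> 'h \<Rightarrow> 'h) \<Rightarrow> (real \<Rightarrow> 'h \<Rightarrow> 'h) \<Rightarrow> bool" where
  "locally_solvable D A F \<longleftrightarrow>
     (\<forall>T\<ge>0. \<forall>R>0. \<exists>\<tau>>0. \<forall>s\<in>{0..T}. \<forall>v\<in>D. norm v \<le> R \<longrightarrow>
        (\<exists>u. u s = v \<and> strong_solution_on D A F {s..s + \<tau>} u))"

definition decays_from ::
  "'h::complex_hilbert set \<Rightarrow> (real \<Rightarrow> 'h \<Rightarrow> 'h) \<Rightarrow> (real \<Rightarrow> 'h \<Rightarrow> 'h) \<Rightarrow> 'h \<Rightarrow> bool" where
  "decays_from D A F v \<longleftrightarrow>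
     (\<exists>u. global_solution D A F v u) \<and>
     (\<forall>u. global_solution D A F v u \<longrightarrow> ((\<lambda>t. norm (u t)) \<longlongrightarrow> 0) at_top)"

definition lyapunov_stable ::
  "'h::complex_hilbert set \<Rightarrow> (real \<Rightarrow> 'h \<Rightarrow> 'h) \<Rightarrow> (real \<Rightarrow> 'h \<Rightarrow> 'h) \<Rightarrow> bool" where
  "lyapunov_stable D A F \<longleftrightarrow>
     (\<exists>\<epsilon>\<^sub>0>0. \<forall>\<epsilon>. 0 < \<epsilon> \<and> \<epsilon> < \<epsilon>\<^sub>0 \<longrightarrow>
        (\<exists>\<delta>>0. \<forall>v\<in>D. norm v < \<delta> \<longrightarrow>
           (\<exists>u. global_solution D A F v u) \<and>
           (\<forall>u. global_solution D A F v u \<longrightarrow> (\<forall>t\<ge>0. norm (u t) \<le> \<epsilon>))))"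

definition asymptotically_stable ::
  "'h::complex_hilbert set \<Rightarrow> (real \<Rightarrow> 'h \<Rightarrow> 'h) \<Rightarrow> (real \<Rightarrow> 'h \<Rightarrow> 'h) \<Rightarrow> bool" where
  "asymptotically_stable D A F \<longleftrightarrow>
     lyapunov_stable D A F \<and> (\<exists>\<delta>>0. \<forall>v\<in>D. norm v < \<delta> \<longrightarrow> decays_from D A F v)"

end

theory Submission
  imports Defs
begin

text \<open>
  Pairing the equation with \<open>u\<close> shows that \<open>n t = norm (u t)\<close> satisfies, with
  \<open>s = b0 + t\<close>,

    \<open>(n\<^sup>2)' \<le> 2 n\<^sup>2 (c0 * n powr p - b1 / s powr d)\<close>.

  The decay rate \<open>b1 / s powr d\<close> of the linear part fades out, so the nonlinear term can only be
  controlled by a bound on \<open>n\<close> that improves with time. Since \<open>d \<le> 1\<close>, the rate is at least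
  \<open>b1 * b0 powr (1 - d) / s\<close>, and the bound to aim at is the one whose \<open>p\<close>-th power is also
  proportional to \<open>1 / s\<close>, namely \<open>n \<le> const * s powr (-1 / p)\<close>. Accordingly consider
  \<open>z = n\<^sup>2 * s powr (2 / p)\<close>, for which

    \<open>z' \<le> (2 z / s) (1 / p + c0 * n powr p * s - b1 * s powr (1 - d))\<close>.

  As \<open>n powr p * s = z powr (p / 2)\<close>, the bracket is nonpositive while
  \<open>z \<le> R\<^sup>2 * b0 powr (2 / p)\<close>, as soon as
  \<open>b1 * b0 powr (1 - d) \<ge> 1 / p + c0 * R powr p * b0\<close> (\<open>weighted_derivative_nonpos\<close>).
  If \<open>norm (u 0) < R\<close>, then \<open>z\<close> starts below this level and therefore can never reach it, so that
  \<open>z\<close> is bounded by its initial value for ever (\<open>le_initial_value_of_barrier\<close>). That is the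
  estimate

    \<open>norm (u t) \<le> norm (u 0) * (b0 / (b0 + t)) powr (1 / p)\<close>

  of \<open>decay_estimate\<close>. It holds on every interval of existence, so solutions stay bounded and
  can be continued to all times (\<open>global_solution_of_bound\<close>); it gives Lyapunov stability with
  \<open>\<delta> = \<epsilon>\<close>, and decay for all initial values of norm less than \<open>R\<close>. The choice
  \<open>R = norm u0 + 1\<close> covers both the given \<open>u0\<close> and all small initial values.
\<close>

section \<open>The real inner product\<close>

lemma norm_add_squared:
  fixes x y :: "'h::complex_hilbert"
  shows "(norm (x + y))\<^sup>2 = (norm x)\<^sup>2 + 2 * Re (cinner x y) + (norm y)\<^sup>2"
proof -
  have right: "cinner z (x + y) = cinner z x + cinner z y" for z
    by (metis cinner_add_left cinner_commute complex_cnj_add)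
  have "(norm (x + y))\<^sup>2 = Re (cinner (x + y) (x + y))"
    by (simp only: cinner_self Re_complex_of_real)
  also have "\<dots> = Re (cinner x x) + Re (cinner x y) + Re (cinner y x) + Re (cinner y y)"
    by (simp add: cinner_add_left right)
  also have "Re (cinner y x) = Re (cinner x y)"
    by (metis cinner_commute complex_cnj(1) complex.sel(1) complex.collapse)
  finally show ?thesis
    by (simp add: cinner_self del: of_real_power)
qed

lemma cinner_scaleR_left:
  fixes x y :: "'h::complex_hilbert"
  shows "Re (cinner (r *\<^sub>R x) y) = r * Re (cinner x y)"
  using cinner_scaleC_left[of "complex_of_real r" x y] by (simp add: scaleC_of_real)

lemma Re_cinner_commute: "Re (cinner x y) = Re (cinner y x)"
  by (metis cinner_commute cnj.sel(1))

text \<open>The norm comes with its triangle inequality, and expanding the square of that inequality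
  leaves exactly the Cauchy-Schwarz inequality for the real part.\<close>

lemma Re_cinner_le_norm:
  fixes x y :: "'h::complex_hilbert"
  shows "Re (cinner x y) \<le> norm x * norm y"
proof -
  have "(norm (x + y))\<^sup>2 \<le> (norm x + norm y)\<^sup>2"
    by (intro power_mono norm_triangle_ineq norm_ge_zero)
  then show ?thesis
    unfolding norm_add_squared by (simp add: power2_sum)
qed

lemma bounded_bilinear_Re_cinner:
  "bounded_bilinear (\<lambda>x y :: 'h::complex_hilbert. Re (cinner x y))"
proof
  show add: "Re (cinner (x + y) z) = Re (cinner x z) + Re (cinner y z)" for x y z :: 'h
    by (simp add: cinner_add_left)
  show "Re (cinner z (x + y)) = Re (cinner z x) + Re (cinner z y)" for x y z :: 'h
    using add Re_cinner_commute by metis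
  show scale: "Re (cinner (r *\<^sub>R x) y) = r *\<^sub>R Re (cinner x y)" for r and x y :: 'h
    by (simp add: cinner_scaleR_left)
  show "Re (cinner y (r *\<^sub>R x)) = r *\<^sub>R Re (cinner y x)" for r and x y :: 'h
    using scale Re_cinner_commute by metis
  have "\<bar>Re (cinner x y)\<bar> \<le> norm x * norm y" for x y :: 'h
    using Re_cinner_le_norm[of x y] Re_cinner_le_norm[of "- 1 *\<^sub>R x" y]
    unfolding cinner_scaleR_left by simp
  then show "\<exists>K. \<forall>x y :: 'h. norm (Re (cinner x y)) \<le> norm x * norm y * K"
    by (intro exI[of _ 1]) simp
qed

lemma norm_squared_has_derivative:
  fixes u :: "real \<Rightarrow> 'h::complex_hilbert"
  assumes "(u has_vector_derivative u') (at t within S)"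
  shows "((\<lambda>t. (norm (u t))\<^sup>2) has_real_derivative 2 * Re (cinner u' (u t))) (at t within S)"
proof -
  have sq: "(norm x)\<^sup>2 = Re (cinner x x)" for x :: 'h
    by (simp add: cinner_self del: of_real_power)
  show ?thesis
    using bounded_bilinear.has_vector_derivative[OF bounded_bilinear_Re_cinner assms assms]
    by (simp add: sq has_real_derivative_iff_has_vector_derivative Re_cinner_commute[of "u t" u'])
qed

section \<open>A barrier principle\<close>

text \<open>A function that starts below the level \<open>K\<close> and has slope \<open>\<le> 0\<close> wherever it is at most \<open>K\<close> cannot
  reach \<open>K\<close>: up to the first time at which it did, it would be nonincreasing, hence still no larger
  than at the start. So it stays where its slope is \<open>\<le> 0\<close>.\<close>

lemma le_initial_value_of_barrier:
  fixes z z' :: "real \<Rightarrow> real"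
  assumes deriv: "\<And>t. t \<in> {0..T} \<Longrightarrow> (z has_real_derivative z' t) (at t within {0..T})"
    and init: "z 0 < K"
    and decr: "\<And>t. t \<in> {0..T} \<Longrightarrow> z t \<le> K \<Longrightarrow> z' t \<le> 0"
    and t: "t \<in> {0..T}"
  shows "z t \<le> z 0"
proof -
  have cont: "continuous_on {0..T} z"
    using deriv DERIV_continuous_on by blast
  have below: "z s \<le> z 0" if s: "s \<in> {0..T}" and K: "\<And>r. 0 < r \<Longrightarrow> r < s \<Longrightarrow> z r \<le> K" for s
  proof (rule DERIV_nonpos_imp_decreasing_open[where f = z and a = 0 and b = s])
    show "0 \<le> s" using s by simp
    show "\<exists>y. (z has_real_derivative y) (at r) \<and> y \<le> 0" if "0 < r" "r < s" for r
      using deriv[of r] decr[of r] K[of r] that s at_within_Icc_at[of 0 r T] by fastforce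
    show "continuous_on {0..s} z"
      using cont s by (auto intro: continuous_on_subset)
  qed
  have "z r < K" if r: "r \<in> {0..T}" for r
  proof (rule ccontr)
    assume "\<not> z r < K"
    \<comment> \<open>The times at or above the level form a compact set; its minimum is the first hitting time.\<close>
    define S where "S = {0..T} \<inter> z -` {K..}"
    have "closed S"
      unfolding S_def by (intro continuous_closed_preimage cont) auto
    then have "compact S"
      unfolding S_def by (meson bounded_Int bounded_closed_interval compact_eq_bounded_closed)
    moreover have "S \<noteq> {}"
      using r \<open>\<not> z r < K\<close> unfolding S_def by auto
    ultimately obtain s where s: "s \<in> S" and least: "\<And>r. r \<in> S \<Longrightarrow> s \<le> r"
      using compact_attains_inf by metis
    have "z s \<le> z 0"
    proof (rule below)
      show "s \<in> {0..T}" using s by (simp add: S_def)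
      show "z r \<le> K" if "0 < r" "r < s" for r
        using least[of r] that s by (force simp: S_def)
    qed
    then show False
      using s init by (simp add: S_def)
  qed
  then show ?thesis
    using below[OF t] t by (meson atLeastAtMost_iff less_imp_le order_trans)
qed

section \<open>Continuation of solutions\<close>

lemma has_vector_derivative_within_bot:
  assumes "at x within S = bot"
  shows "(f has_vector_derivative f') (at x within S)"
  using assms
  by (simp add: has_vector_derivative_def has_derivative_bot bounded_linear_scaleR_left)

lemma has_vector_derivative_within_Un:
  assumes "(f has_vector_derivative f') (at x within S)"
    and "(f has_vector_derivative f') (at x within T)"
  shows "(f has_vector_derivative f') (at x within S \<union> T)"
  using assms unfolding has_vector_derivative_def has_derivative_within
  by (simp add: Lim_within_Un)

lemma strong_solution_on_derivative:
  assumes "strong_solution_on D A F I u" "t \<in> I"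
  shows "(u has_vector_derivative A t (u t) + F t (u t)) (at t within I)"
  using assms by (simp add: strong_solution_on_def)

lemma strong_solution_on_subset:
  assumes "strong_solution_on D A F I u" "J \<subseteq> I"
  shows "strong_solution_on D A F J u"
  using assms unfolding strong_solution_on_def
  by (meson has_vector_derivative_within_subset subsetD)

lemma strong_solution_on_cong:
  assumes "strong_solution_on D A F I u" "\<And>t. t \<in> I \<Longrightarrow> w t = u t"
  shows "strong_solution_on D A F I w"
  using assms unfolding strong_solution_on_def
  by (metis has_vector_derivative_transform)

text \<open>At the junction \<open>s\<close> the left derivative of \<open>u\<close> and the right derivative of \<open>w\<close> are both
  the right-hand side of the equation at the common value, so the glued function is differentiable
  there and solves the equation across \<open>s\<close>.\<close>

lemma strong_solution_on_concatenate:
  assumes u: "strong_solution_on D A F {r..s} u" and w: "strong_solution_on D A F {s..t} w"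
    and match: "u s = w s" and "r \<le> s" "s \<le> t"
  shows "strong_solution_on D A F {r..t} (\<lambda>x. if x \<le> s then u x else w x)"
proof -
  let ?v = "\<lambda>x. if x \<le> s then u x else w x"
  have eq: "{r..t} = {r..s} \<union> {s..t}" using assms by auto
  have v1: "strong_solution_on D A F {r..s} ?v"
    using u by (rule strong_solution_on_cong) auto
  have v2: "strong_solution_on D A F {s..t} ?v"
    using w by (rule strong_solution_on_cong) (use match in auto)
  show ?thesis
    unfolding strong_solution_on_def
  proof (intro ballI conjI)
    fix x assume x: "x \<in> {r..t}"
    show "?v x \<in> D"
      using u w x unfolding strong_solution_on_def by auto
    let ?f = "A x (?v x) + F x (?v x)"
    have "(?v has_vector_derivative ?f) (at x within {r..s})"
    proof (cases "x \<le> s")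
      case True
      then show ?thesis using strong_solution_on_derivative[OF v1, of x] x by simp
    next
      case False
      \<comment> \<open>Away from the interval the within-derivative is vacuous, so both parts can be united.\<close>
      then have "at x within {r..s} = bot"
        by (intro not_in_closure_trivial_limitI) auto
      then show ?thesis by (rule has_vector_derivative_within_bot)
    qed
    moreover have "(?v has_vector_derivative ?f) (at x within {s..t})"
    proof (cases "s \<le> x")
      case True
      then show ?thesis using strong_solution_on_derivative[OF v2, of x] x by simp
    next
      case False
      then have "at x within {s..t} = bot"
        by (intro not_in_closure_trivial_limitI) auto
      then show ?thesis by (rule has_vector_derivative_within_bot)
    qed
    ultimately show "(?v has_vector_derivative ?f) (at x within {r..t})"
      unfolding eq by (rule has_vector_derivative_within_Un)
  qed
qed

text \<open>Under an a priori bound, local solvability supplies a step length \<open>\<tau>\<close> that serves all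
  restarting times up to \<open>T + 1\<close>, so finitely many steps lengthen a solution on \<open>{0..T}\<close> by one
  unit of time. The lengthening is made to agree with the given solution; iterating it by dependent
  choice yields a coherent sequence whose union is a global solution.\<close>

lemma global_solution_of_bound:
  fixes v :: "'h::complex_hilbert"
  assumes solvable: "locally_solvable D A F" and v: "v \<in> D" and R: "R > 0"
    and bound: "\<And>T u. 0 \<le> T \<Longrightarrow> u 0 = v \<Longrightarrow> strong_solution_on D A F {0..T} u \<Longrightarrow> norm (u T) \<le> R"
  shows "\<exists>u. global_solution D A F v u"
proof -
  define sol where "sol T u \<longleftrightarrow> u 0 = v \<and> strong_solution_on D A F {0..T} u" for T u
  have extend: "\<exists>w. sol (T + 1) w \<and> (\<forall>t\<le>T. w t = u t)" if T: "0 \<le> T" and u: "sol T u" for T u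
  proof -
    obtain \<tau> where "\<tau> > 0" and
      \<tau>: "\<And>s x. s \<in> {0..T + 1} \<Longrightarrow> x \<in> D \<Longrightarrow> norm x \<le> R \<Longrightarrow>
            \<exists>w. w s = x \<and> strong_solution_on D A F {s..s + \<tau>} w"
      using solvable R T unfolding locally_solvable_def by (metis add_increasing2 zero_le_one)
    \<comment> \<open>Steps of length \<open>1 / N\<close> make the last one end exactly at \<open>T + 1\<close>.\<close>
    obtain N where N: "N > 0" "inverse (real N) < \<tau>"
      using \<open>\<tau> > 0\<close> reals_Archimedean by (metis zero_less_Suc)
    have "\<exists>w. sol (T + real k / N) w \<and> (\<forall>t\<le>T. w t = u t)" if "k \<le> N" for k
      using that
    proof (induction k)
      case 0
      then show ?case using u by auto
    next
      case (Suc k)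
      then obtain w where w: "sol (T + real k / N) w" "\<forall>t\<le>T. w t = u t" by auto
      define s where "s = T + real k / N"
      have s: "s \<in> {0..T + 1}" "T \<le> s"
        using T Suc.prems N by (auto simp: s_def)
      have ws: "w s \<in> D" "norm (w s) \<le> R"
        using w(1) bound[of s w] s unfolding sol_def s_def[symmetric] strong_solution_on_def by auto
      obtain x where x: "x s = w s" "strong_solution_on D A F {s..s + \<tau>} x"
        using \<tau>[OF s(1) ws] by auto
      have step: "T + real (Suc k) / N = s + inverse N"
        using N by (simp add: s_def field_simps)
      have "strong_solution_on D A F {s..s + inverse N} x"
        using x(2) by (rule strong_solution_on_subset) (use N in auto)
      then have "sol (s + inverse N) (\<lambda>t. if t \<le> s then w t else x t)"
        using w(1) x(1) s N unfolding sol_def s_def[symmetric]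
        by (auto intro!: strong_solution_on_concatenate)
      then show ?case
        unfolding step using w(2) s by (intro exI[of _ "\<lambda>t. if t \<le> s then w t else x t"]) auto
    qed
    from this[of N] show ?thesis using N by simp
  qed
  have "\<exists>U. \<forall>n. sol (real n) (U n) \<and> (\<forall>t\<le>real n. U (Suc n) t = U n t)"
  proof (rule dependent_nat_choice)
    have "strong_solution_on D A F {0..0} (\<lambda>_. v)"
      using v by (simp add: strong_solution_on_def has_vector_derivative_within_bot trivial_limit_within
          islimpt_finite)
    then show "\<exists>u. sol (real 0) u"
      unfolding sol_def by auto
  next
    fix u n assume "sol (real n) u"
    then show "\<exists>w. sol (real (Suc n)) w \<and> (\<forall>t\<le>real n. w t = u t)"
      using extend[of "real n" u] by (simp add: add.commute)
  qed
  then obtain U where U: "\<And>n. sol (real n) (U n)" "\<And>n t. t \<le> real n \<Longrightarrow> U (Suc n) t = U n t"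
    by blast
  have agree: "U m t = U n t" if "n \<le> m" "t \<le> real n" for m n t
    using that(1) by (induction m rule: dec_induct) (use U(2) that(2) in auto)
  define u where "u t = U (nat \<lceil>t\<rceil>) t" for t
  have u_eq: "u t = U n t" if "t \<le> real n" for n t
    unfolding u_def using that by (intro agree[symmetric]) linarith+
  have "strong_solution_on D A F {0..} u"
    unfolding strong_solution_on_def
  proof (intro ballI conjI)
    fix t :: real assume t: "t \<in> {0..}"
    \<comment> \<open>Strictly beyond \<open>t\<close>, so that \<open>{0..n}\<close> and \<open>{0..}\<close> agree near \<open>t\<close>.\<close>
    define n where "n = Suc (nat \<lceil>t\<rceil>)"
    have n: "t < real n" unfolding n_def by linarith
    have sol_n: "strong_solution_on D A F {0..real n} u"
      using U(1)[of n] unfolding sol_def by (auto intro: strong_solution_on_cong[OF _ u_eq])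
    then show "u t \<in> D"
      using t n unfolding strong_solution_on_def by auto
    have "at t within {0..real n} = at t within {0..}"
      by (rule at_within_nhd[of _ "{..<real n}"]) (use n in auto)
    then show "(u has_vector_derivative A t (u t) + F t (u t)) (at t within {0..})"
      using strong_solution_on_derivative[OF sol_n, of t] t n by simp
  qed
  moreover have "u 0 = v"
    using u_eq[of 0 0] U(1)[of 0] by (simp add: sol_def)
  ultimately show ?thesis
    unfolding global_solution_def by blast
qed

section \<open>The decay estimate\<close>

text \<open>The sign of the derivative of \<open>n\<^sup>2 * s powr (2 / p)\<close> at a time where \<open>n\<close> is the norm of the
  solution, \<open>s = b0 + t\<close>, and \<open>2 e\<close> is the derivative of \<open>n\<^sup>2\<close>. Raised to the power \<open>p / 2\<close>, the
  barrier condition reads \<open>n powr p * s \<le> R powr p * b0\<close>; thus in units of \<open>1 / s\<close> the nonlinear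
  growth and the growth \<open>1 / p\<close> of the weight are bounded by constants, while the dissipation
  contributes \<open>b1 * s powr (1 - d)\<close>, which by \<open>d \<le> 1\<close> is smallest at \<open>s = b0\<close>.\<close>

lemma weighted_derivative_nonpos:
  fixes n s :: real
  assumes pos: "0 < b0" "0 < c0" "0 < p" "0 < R" and s: "b0 \<le> s" and d: "d \<le> 1"
    and b1: "b1 \<ge> (1 / p + c0 * R powr p * b0) / b0 powr (1 - d)"
    and n: "0 \<le> n" and K: "n\<^sup>2 * s powr (2 / p) \<le> R\<^sup>2 * b0 powr (2 / p)"
    and e: "e \<le> - (b1 / s powr d) * n\<^sup>2 + c0 * n powr (1 + p) * n"
  shows "2 * e * s powr (2 / p) + n\<^sup>2 * ((2 / p) * s powr (2 / p - 1)) \<le> 0"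
proof (cases "n = 0")
  case True
  then show ?thesis using e by (simp add: mult_nonpos_nonneg)
next
  case False
  then have n: "n > 0" using n by simp
  have "s > 0" using pos s by simp
  have scale: "(x\<^sup>2 * r powr (2 / p)) powr (p / 2) = x powr p * r" if "x > 0" "r > 0" for x r :: real
  proof -
    have "(x\<^sup>2 * r powr (2 / p)) powr (p / 2) = (x powr 2) powr (p / 2) * (r powr (2 / p)) powr (p / 2)"
      using that by (simp add: powr_mult)
    also have "\<dots> = x powr p * r"
      using that pos unfolding powr_powr by simp
    finally show ?thesis .
  qed
  have nonlinear: "n powr p * s \<le> R powr p * b0"
    using powr_mono2[OF _ _ K, of "p / 2"] pos n \<open>s > 0\<close> by (simp add: scale)
  have B: "1 / p + c0 * R powr p * b0 \<le> b1 * b0 powr (1 - d)"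
    using b1 pos by (simp add: pos_divide_le_eq)
  have "0 \<le> (1 / p + c0 * R powr p * b0) / b0 powr (1 - d)"
    using pos by simp
  then have "0 \<le> b1" using b1 by linarith
  then have "b1 * b0 powr (1 - d) \<le> b1 * s powr (1 - d)"
    using pos s d by (intro mult_left_mono powr_mono2) auto
  also have "\<dots> = (b1 / s powr d) * s"
    using \<open>s > 0\<close> by (simp add: powr_diff)
  finally have dissip: "1 / p + c0 * R powr p * b0 \<le> (b1 / s powr d) * s"
    using B by linarith
  have "c0 * (n powr p * s) \<le> c0 * (R powr p * b0)"
    using nonlinear pos by (intro mult_left_mono) auto
  with dissip have rate: "1 / p + c0 * n powr p * s - (b1 / s powr d) * s \<le> 0"
    by (simp add: mult.assoc)
  have "n powr (1 + p) * n = n\<^sup>2 * n powr p"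
    using n by (simp add: powr_add power2_eq_square)
  then have e': "e \<le> n\<^sup>2 * (c0 * n powr p - b1 / s powr d)"
    using e by (simp add: algebra_simps)
  have split: "s powr (2 / p) = s powr (2 / p - 1) * s"
    using \<open>s > 0\<close> by (simp add: powr_diff)
  have "2 * e * s powr (2 / p) \<le> 2 * (n\<^sup>2 * (c0 * n powr p - b1 / s powr d)) * s powr (2 / p)"
    using e' by (intro mult_right_mono) auto
  then have "2 * e * s powr (2 / p) + n\<^sup>2 * ((2 / p) * s powr (2 / p - 1))
      \<le> 2 * n\<^sup>2 * s powr (2 / p - 1) * (1 / p + c0 * n powr p * s - (b1 / s powr d) * s)"
    unfolding split by (simp add: algebra_simps)
  also have "\<dots> \<le> 0"
    using rate by (intro mult_nonneg_nonpos) auto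
  finally show ?thesis .
qed

lemma decay_estimate:
  fixes u :: "real \<Rightarrow> 'h::complex_hilbert"
  assumes pos: "0 < b0" "0 < c0" "0 < p" "0 < R" and d: "d \<le> 1"
    and b1: "b1 \<ge> (1 / p + c0 * R powr p * b0) / b0 powr (1 - d)"
    and dissipative:
      "\<And>t x. 0 \<le> t \<Longrightarrow> x \<in> D \<Longrightarrow> Re (cinner (A t x) x) \<le> - (b1 / (b0 + t) powr d) * (norm x)\<^sup>2"
    and growth: "\<And>t x. 0 \<le> t \<Longrightarrow> norm (F t x) \<le> c0 * norm x powr (1 + p)"
    and sol: "strong_solution_on D A F {0..T} u" and init: "norm (u 0) < R" and "0 \<le> T"
  shows "norm (u T) \<le> norm (u 0) * (b0 / (b0 + T)) powr (1 / p)"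
proof -
  define e where "e t = Re (cinner (A t (u t) + F t (u t)) (u t))" for t
  define z where "z t = (norm (u t))\<^sup>2 * (b0 + t) powr (2 / p)" for t
  define z' where
    "z' t = 2 * e t * (b0 + t) powr (2 / p)
       + (norm (u t))\<^sup>2 * ((2 / p) * (b0 + t) powr (2 / p - 1))" for t
  have "z T \<le> z 0"
  proof (rule le_initial_value_of_barrier)
    fix t assume t: "t \<in> {0..T}"
    have u: "u t \<in> D" "(u has_vector_derivative A t (u t) + F t (u t)) (at t within {0..T})"
      using sol t unfolding strong_solution_on_def by auto
    have "((\<lambda>t. (b0 + t) powr (2 / p)) has_real_derivative (2 / p) * (b0 + t) powr (2 / p - 1))
        (at t within {0..T})"
      using t pos by (auto intro!: derivative_eq_intros)
    from DERIV_mult[OF norm_squared_has_derivative[OF u(2)] this]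
    show "(z has_real_derivative z' t) (at t within {0..T})"
      unfolding z_def z'_def e_def by (simp add: algebra_simps)
    have "Re (cinner (F t (u t)) (u t)) \<le> norm (F t (u t)) * norm (u t)"
      by (rule Re_cinner_le_norm)
    also have "\<dots> \<le> c0 * norm (u t) powr (1 + p) * norm (u t)"
      using growth t by (intro mult_right_mono) auto
    finally have "e t \<le> - (b1 / (b0 + t) powr d) * (norm (u t))\<^sup>2
        + c0 * norm (u t) powr (1 + p) * norm (u t)"
      using dissipative[of t "u t"] u(1) t unfolding e_def cinner_add_left by simp
    then show "z' t \<le> 0" if "z t \<le> R\<^sup>2 * b0 powr (2 / p)"
      unfolding z'_def using that t pos d b1
      by (intro weighted_derivative_nonpos[where R = R and ?c0.0 = c0]) (auto simp: z_def)
  next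
    have "(norm (u 0))\<^sup>2 < R\<^sup>2"
      using init by (intro power_strict_mono) auto
    then show "z 0 < R\<^sup>2 * b0 powr (2 / p)"
      using pos by (simp add: z_def)
  qed (use \<open>0 \<le> T\<close> in auto)
  then have "(norm (u T))\<^sup>2 \<le> (norm (u 0))\<^sup>2 * (b0 / (b0 + T)) powr (2 / p)"
    using pos \<open>0 \<le> T\<close> by (simp add: z_def powr_divide pos_le_divide_eq)
  also have "(b0 / (b0 + T)) powr (2 / p) = ((b0 / (b0 + T)) powr (1 / p))\<^sup>2"
    using pos by (simp add: power2_eq_square flip: powr_add)
  finally show ?thesis
    unfolding power_mult_distrib[symmetric] by (rule power2_le_imp_le) simp
qed

section \<open>Asymptotic stability\<close>

theorem theorem1:
  fixes u0 :: "'h::complex_hilbert" and b0 c0 d p :: real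
  assumes "b0 > 0" and "c0 > 0" and "p > 0" and "0 < d" and "d \<le> 1"
  shows "\<exists>B>0. \<forall>b1\<ge>B. \<forall>(D :: 'h set) (A :: real \<Rightarrow> 'h \<Rightarrow> 'h) (F :: real \<Rightarrow> 'h \<Rightarrow> 'h).
     (\<forall>t\<ge>0. closed_densely_defined_operator D (A t)) \<and>
     (\<forall>t\<ge>0. \<forall>u\<in>D. Re (cinner (A t u) u) \<le> - (b1 / (b0 + t) powr d) * (norm u)\<^sup>2) \<and>
     local_lipschitz {0..} UNIV F \<and>
     (\<forall>t\<ge>0. \<forall>u. norm (F t u) \<le> c0 * norm u powr (1 + p)) \<and>
     locally_solvable D A F \<and>
     u0 \<in> D
     \<longrightarrow> asymptotically_stable D A F \<and> decays_from D A F u0"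
proof -
  define R where "R = norm u0 + 1"
  have R: "R > 0" "R \<ge> 1" "norm u0 < R"
    unfolding R_def by (auto simp: add_nonneg_pos)
  define B where "B = (1 / p + c0 * R powr p * b0) / b0 powr (1 - d)"
  have "B > 0"
    unfolding B_def using assms R by (auto intro!: divide_pos_pos add_pos_pos)
  moreover have "asymptotically_stable D A F \<and> decays_from D A F u0"
    if b1: "b1 \<ge> B"
      and dissip: "\<forall>t\<ge>0. \<forall>u\<in>D. Re (cinner (A t u) u) \<le> - (b1 / (b0 + t) powr d) * (norm u)\<^sup>2"
      and growth: "\<forall>t\<ge>0. \<forall>u. norm (F t u) \<le> c0 * norm u powr (1 + p)"
      and solvable: "locally_solvable D A F" and "u0 \<in> D"
    for b1 and D :: "'h set" and A F :: "real \<Rightarrow> 'h \<Rightarrow> 'h"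
  proof -
    have decay: "norm (u T) \<le> norm (u 0) * (b0 / (b0 + T)) powr (1 / p)"
      if "strong_solution_on D A F {0..T} u" "norm (u 0) < R" "0 \<le> T" for u T
      by (rule decay_estimate[where R = R and ?c0.0 = c0 and d = d and ?b1.0 = b1])
        (use assms R b1 dissip growth that in \<open>auto simp: B_def\<close>)
    have bound: "norm (u T) \<le> norm (u 0)"
      if "strong_solution_on D A F {0..T} u" "norm (u 0) < R" "0 \<le> T" for u T
    proof -
      have "(b0 / (b0 + T)) powr (1 / p) \<le> 1"
        using \<open>b0 > 0\<close> \<open>p > 0\<close> \<open>0 \<le> T\<close> by (intro powr_le1) auto
      then show ?thesis
        using decay[OF that] by (smt (verit) mult_left_le norm_ge_zero)
    qed
    have restrict: "strong_solution_on D A F {0..T} u \<and> u 0 = v"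
      if "global_solution D A F v u" for u v T
      using that unfolding global_solution_def by (auto intro: strong_solution_on_subset)
    have exist: "\<exists>u. global_solution D A F v u" if v: "v \<in> D" "norm v < R" for v
      using solvable v(1) R(1)
      by (rule global_solution_of_bound) (use bound v(2) in fastforce)
    have decays: "decays_from D A F v" if v: "v \<in> D" "norm v < R" for v
      unfolding decays_from_def
    proof (intro conjI allI impI)
      fix u assume u: "global_solution D A F v u"
      have "((\<lambda>t. b0 / (b0 + t)) \<longlongrightarrow> 0) at_top"
        by (intro tendsto_divide_0[OF tendsto_const] filterlim_at_top_imp_at_infinity
            filterlim_tendsto_add_at_top[OF tendsto_const] filterlim_ident)
      then have "((\<lambda>t. (b0 / (b0 + t)) powr (1 / p)) \<longlongrightarrow> 0) at_top"
        by (rule tendsto_zero_powrI[OF _ tendsto_const])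
          (use assms in \<open>auto intro!: eventually_mono[OF eventually_ge_at_top[of 0]]\<close>)
      then have "((\<lambda>t. norm v * (b0 / (b0 + t)) powr (1 / p)) \<longlongrightarrow> 0) at_top"
        by (rule tendsto_mult_right_zero)
      moreover have "eventually (\<lambda>t. norm (u t) \<le> norm v * (b0 / (b0 + t)) powr (1 / p)) at_top"
        using eventually_ge_at_top[of 0]
        by eventually_elim (use decay restrict[OF u] v in fastforce)
      ultimately show "((\<lambda>t. norm (u t)) \<longlongrightarrow> 0) at_top"
        by (intro Lim_null_comparison[of "\<lambda>t. norm (u t)"]) auto
    qed (use exist v in blast)
    have "lyapunov_stable D A F"
      unfolding lyapunov_stable_def
    proof (rule exI[of _ R], intro conjI allI impI)
      fix \<epsilon> assume \<epsilon>: "0 < \<epsilon> \<and> \<epsilon> < R"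
      have "norm (u t) \<le> \<epsilon>" if "norm v < \<epsilon>" "global_solution D A F v u" "0 \<le> t" for v u t
        using bound[of t u] restrict[OF that(2), of t] that \<epsilon> by auto
      then show "\<exists>\<delta>>0. \<forall>v\<in>D. norm v < \<delta> \<longrightarrow> (\<exists>u. global_solution D A F v u) \<and>
          (\<forall>u. global_solution D A F v u \<longrightarrow> (\<forall>t\<ge>0. norm (u t) \<le> \<epsilon>))"
        using \<epsilon> exist by (intro exI[of _ \<epsilon>]) auto
    qed (rule R)
    then show ?thesis
      unfolding asymptotically_stable_def using decays R \<open>u0 \<in> D\<close> by blast
  qed
  ultimately show ?thesis
    by blast
qed

end
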